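(* For every even integer $k \ge 4$ and all integers $p \ge k+2$ and $q \ge k+1$, $$r_k(p,q) \ge 2\cdot\bigl(r_k(p-1,q)-1\bigr)+1.$$ For every odd integer $k \ge 5$ and all integers $p \ge k+2$ and $q \ge k+2$, the same inequality $$r_k(p,q) \ge 2\cdot\bigl(r_k(p-1,q)-1\bigr)+1$$ holds.
   Context: For integers $k,p,q$, the Ramsey number $r_k(p,q)$ is the smallest integer $N$ such that for every coloring of all $k$-element subsets of $\{1,\dots,N\}$ with the colors red and blue, there exist either $p$ elements of $\{1,\dots,N\}$ all of whose $k$-element subsets are red, or $q$ elements of $\{1,\dots,N\}$ all of whose $k$-element subsets are blue. *)

theory Defs
  imports Complex_Main "HOL-Library.Ramsey"
begin

text \<open>
  In \<^term>\<open>partn_lst {1..N} [p, q] k\<close> a coloring is a map from the \<open>k\<close>-element subsets of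
  \<^term>\<open>{1..N}\<close> to \<open>{0, 1}\<close>; color \<open>0\<close> (red) is paired with \<open>p\<close> and color \<open>1\<close> (blue) with \<open>q\<close>.
\<close>

definition ramsey_number :: "nat \<Rightarrow> nat \<Rightarrow> nat \<Rightarrow> nat" where
  "ramsey_number k p q = (LEAST N. partn_lst {1..N} [p, q] k)"

lemma partn_lst_red_blue_iff:
  fixes N k p q :: nat
  shows "partn_lst {1..N} [p, q] k \<longleftrightarrow>
    (\<forall>red :: nat set \<Rightarrow> bool.
       (\<exists>H \<subseteq> {1..N}. card H = p \<and> (\<forall>e \<subseteq> H. card e = k \<longrightarrow> red e)) \<or>
       (\<exists>H \<subseteq> {1..N}. card H = q \<and> (\<forall>e \<subseteq> H. card e = k \<longrightarrow> \<not> red e)))"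
    (is "?L \<longleftrightarrow> ?R")
proof
  have fin: "finite H" if "H \<subseteq> {1..N}" for H
    using that by (rule finite_subset) simp
  show ?R if L: ?L
  proof
    fix red :: "nat set \<Rightarrow> bool"
    define f where "f = (\<lambda>e. if red e then 0 else 1 :: nat)"
    have "f \<in> nsets {1..N} k \<rightarrow> {..<length [p, q]}"
      by (auto simp: f_def)
    with L obtain i H where "i < length [p, q]" and H: "H \<in> nsets {1..N} ([p, q] ! i)"
      and sub: "f ` nsets H k \<subseteq> {i}"
      unfolding partn_lst_def monochromatic_def by blast
    then have i: "i < 2" by simp
    from H have HN: "H \<subseteq> {1..N}" and cH: "card H = [p, q] ! i" by (auto simp: nsets_def)
    have *: "f e = i" if "e \<subseteq> H" "card e = k" for e
      using that sub fin[OF HN] finite_subset[of e H] by (auto simp: nsets_def)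
    from i consider "i = 0" | "i = 1" by linarith
    then show "(\<exists>H \<subseteq> {1..N}. card H = p \<and> (\<forall>e \<subseteq> H. card e = k \<longrightarrow> red e)) \<or>
       (\<exists>H \<subseteq> {1..N}. card H = q \<and> (\<forall>e \<subseteq> H. card e = k \<longrightarrow> \<not> red e))"
    proof cases
      case 1
      have "\<forall>e \<subseteq> H. card e = k \<longrightarrow> red e"
        using * 1 unfolding f_def by (metis zero_neq_one)
      moreover have "card H = p" using cH 1 by simp
      ultimately have "H \<subseteq> {1..N} \<and> card H = p \<and> (\<forall>e \<subseteq> H. card e = k \<longrightarrow> red e)"
        using HN by (intro conjI)
      then show ?thesis by (intro disjI1) (rule exI)
    next
      case 2
      have "\<forall>e \<subseteq> H. card e = k \<longrightarrow> \<not> red e"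
        using * 2 unfolding f_def by (metis zero_neq_one)
      moreover have "card H = q" using cH 2 by simp
      ultimately have "H \<subseteq> {1..N} \<and> card H = q \<and> (\<forall>e \<subseteq> H. card e = k \<longrightarrow> \<not> red e)"
        using HN by (intro conjI)
      then show ?thesis by (intro disjI2) (rule exI)
    qed
  qed
  show ?L if R: ?R
    unfolding partn_lst_def monochromatic_def
  proof
    fix f :: "nat set \<Rightarrow> nat"
    assume f: "f \<in> nsets {1..N} k \<rightarrow> {..<length [p, q]}"
    from R[rule_format, of "\<lambda>e. f e = 0"]
    show "\<exists>i<length [p, q]. \<exists>H\<in>nsets {1..N} ([p, q] ! i). f ` nsets H k \<subseteq> {i}"
    proof
      assume "\<exists>H \<subseteq> {1..N}. card H = p \<and> (\<forall>e \<subseteq> H. card e = k \<longrightarrow> f e = 0)"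
      then obtain H where "H \<subseteq> {1..N}" "card H = p" "\<forall>e \<subseteq> H. card e = k \<longrightarrow> f e = 0" by blast
      then have "H \<in> nsets {1..N} ([p, q] ! 0)" "f ` nsets H k \<subseteq> {0}"
        using fin by (auto simp: nsets_def)
      moreover have "0 < length [p, q]" by simp
      ultimately show ?thesis by blast
    next
      assume "\<exists>H \<subseteq> {1..N}. card H = q \<and> (\<forall>e \<subseteq> H. card e = k \<longrightarrow> f e \<noteq> 0)"
      then obtain H where H: "H \<subseteq> {1..N}" "card H = q" "\<forall>e \<subseteq> H. card e = k \<longrightarrow> f e \<noteq> 0" by blast
      have "f e = 1" if "e \<in> nsets H k" for e
      proof -
        have "e \<in> nsets {1..N} k" using that nsets_mono[OF H(1)] by blast
        then have "f e < 2" by (metis Pi_mem f lessThan_iff length_Cons list.size(3) numeral_2_eq_2)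
        moreover have "f e \<noteq> 0" using that H(3) by (auto simp: nsets_def)
        ultimately show ?thesis by linarith
      qed
      moreover have "H \<in> nsets {1..N} ([p, q] ! 1)"
        using H fin by (auto simp: nsets_def)
      moreover have "1 < length [p, q]" by simp
      ultimately show ?thesis
        by (intro exI[of _ 1] conjI bexI[of _ H] image_subsetI) simp_all
    qed
  qed
qed

lemma partn_lst_ramsey_number:
  "partn_lst {1..ramsey_number k p q} [p, q] k"
proof -
  obtain N :: nat where N: "partn_lst {..<N} [p, q] k"
    using ramsey_full by blast
  have "bij_betw Suc {..<N} {1..N}"
    by (rule bij_betw_byWitness[where f' = "\<lambda>n. n - 1"]) auto
  then have inj: "inj_on Suc {..<N}" and im: "Suc ` {..<N} = {1..N}"
    by (auto simp: bij_betw_def)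
  have "partn_lst {1..N} [p, q] k"
    unfolding partn_lst_def monochromatic_def
  proof
    fix f :: "nat set \<Rightarrow> nat"
    assume f: "f \<in> nsets {1..N} k \<rightarrow> {..<length [p, q]}"
    have "f \<circ> (\<lambda>X. Suc ` X) \<in> nsets {..<N} k \<rightarrow> {..<length [p, q]}"
      using nsets_compose_image_funcset[OF f _ inj] im by blast
    with N obtain i H where i: "i < length [p, q]" and H: "H \<in> nsets {..<N} ([p, q] ! i)"
      and sub: "(f \<circ> (\<lambda>X. Suc ` X)) ` nsets H k \<subseteq> {i}"
      unfolding partn_lst_def monochromatic_def by blast
    have "bij_betw Suc H (Suc ` H)" by (simp add: bij_betw_def)
    from bij_betw_nsets[OF this] have "nsets (Suc ` H) k = (\<lambda>X. Suc ` X) ` nsets H k"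
      by (simp add: bij_betw_def)
    with sub have "f ` nsets (Suc ` H) k \<subseteq> {i}" by (simp add: image_comp)
    moreover have "Suc ` H \<in> nsets {1..N} ([p, q] ! i)"
      using H im by (auto simp: nsets_def card_image)
    ultimately show "\<exists>i<length [p, q]. \<exists>H\<in>nsets {1..N} ([p, q] ! i). f ` nsets H k \<subseteq> {i}"
      using i by blast
  qed
  then show ?thesis
    unfolding ramsey_number_def by (rule LeastI)
qed

end

theory Submission
  imports Defs
begin

text \<open>
  Put \<open>n = r\<^sub>k(p - 1, q) - 1\<close> and fix a coloring of the \<open>k\<close>-subsets of \<open>{1..n}\<close> with no red
  set of size \<open>p - 1\<close> and no blue set of size \<open>q\<close>.  Double every point: let \<open>f\<close> map \<open>{1..2n}\<close> onto
  \<open>{1..n}\<close> with all fibres of size 2.  The \<^emph>\<open>defect\<close> of a \<open>k\<close>-subset \<open>e\<close> of \<open>{1..2n}\<close> is the number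
  \<open>k - |f(e)|\<close> of fibres that it contains.  A set of defect \<open>0\<close> receives the color of its
  image; a set of positive defect is red if the defect is odd, and blue if it is even.

  Let \<open>H\<close> be a set with \<open>h\<close> points whose image has \<open>t\<close> points, so that it contains \<open>d = h - t\<close>
  fibres.  Then \<open>H\<close> has a \<open>k\<close>-subset of defect \<open>j\<close> whenever \<open>k - t \<le> j \<le> d\<close> and \<open>2j \<le> k\<close>
  (\<open>exists_subset_with_defect\<close>).  If \<open>t \<ge> k\<close>, this gives the defect \<open>1\<close> when \<open>d \<ge> 1\<close>, and the
  defect \<open>2\<close> when \<open>d \<ge> 2\<close>, because \<open>k \<ge> 4\<close>.  If \<open>t < k\<close>, it gives both \<open>k - t\<close> and
  \<open>k - t + 1\<close>: the second is at most \<open>d\<close> because \<open>h \<ge> k + 1\<close>, and at most \<open>k / 2\<close> because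
  \<open>2t \<ge> h\<close> and \<open>h \<ge> k + 1\<close> for even \<open>k\<close>, \<open>h \<ge> k + 2\<close> for odd \<open>k\<close>; one of the two is odd
  and the other even.  Hence an odd defect occurs if \<open>d \<ge> 1\<close>, so that \<open>H\<close> is not blue, and a
  positive even defect occurs if \<open>d \<ge> 2\<close>, so that \<open>H\<close> is not red.
  Consequently a blue set of size \<open>q\<close> has \<open>d = 0\<close>, and a
  red set of size \<open>p\<close> has \<open>d \<le> 1\<close>.  These sets project to sets of size \<open>q\<close> and at least \<open>p - 1\<close>
  that are monochromatic for the given coloring, which is impossible.
\<close>

section \<open>Maps with fibres of size at most two\<close>

text \<open>Each fibre of \<open>f\<close> meets \<open>H\<close> in at most two points: among any three points of \<open>H\<close> with the
  same image, two coincide.\<close>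

definition fibres_le_two :: "('a \<Rightarrow> 'b) \<Rightarrow> 'a set \<Rightarrow> bool" where
  "fibres_le_two f H \<longleftrightarrow>
    (\<forall>x\<in>H. \<forall>y\<in>H. \<forall>z\<in>H. f x = f y \<longrightarrow> f y = f z \<longrightarrow> x = y \<or> y = z \<or> x = z)"

lemma exists_transversal:
  obtains T where "T \<subseteq> H" "inj_on f T" "f ` T = f ` H"
proof -
  have "\<exists>T\<subseteq>H. inj_on f T \<and> f ` H = f ` T"
    using subset_image_inj[of "f ` H" f H] by simp
  then show ?thesis using that by metis
qed

text \<open>Outside a transversal a map with fibres of size at most two is injective, since the
  transversal already uses up one point of each fibre.\<close>

lemma inj_on_off_transversal:
  assumes "fibres_le_two f H" "T \<subseteq> H" "f ` T = f ` H"
  shows "inj_on f (H - T)"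
proof (rule inj_onI)
  fix x y assume x: "x \<in> H - T" and y: "y \<in> H - T" and eq: "f x = f y"
  have "f y \<in> f ` T" using y assms(3) by blast
  then obtain z where z: "z \<in> T" "f y = f z" by blast
  have "x = y \<or> y = z \<or> x = z"
    using assms(1,2) x y z eq unfolding fibres_le_two_def by blast
  then show "x = y" using x y z(1) by blast
qed

text \<open>The set constructed consists of \<open>j\<close> fibres together with \<open>k - 2 * j\<close> further points of a
  transversal.\<close>

lemma exists_subset_with_defect:
  assumes fin: "finite H" and two: "fibres_le_two f H"
    and lower: "k \<le> card (f ` H) + j" and upper: "card (f ` H) + j \<le> card H" "2 * j \<le> k"
  shows "\<exists>e\<subseteq>H. card e = k \<and> card (f ` e) + j = k"
proof -
  obtain T where T: "T \<subseteq> H" "inj_on f T" "f ` T = f ` H"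
    by (rule exists_transversal)
  have finT: "finite T" using T(1) fin by (rule finite_subset)
  have cT: "card T = card (f ` H)" using card_image[OF T(2)] T(3) by simp
  have "j \<le> card (H - T)" using card_Diff_subset[OF finT T(1)] cT upper(1) by simp
  then obtain J where J: "J \<subseteq> H - T" "card J = j" "finite J"
    by (rule obtain_subset_with_card_n)
  have cfJ: "card (f ` J) = j"
    using inj_on_subset[OF inj_on_off_transversal[OF two T(1,3)] J(1)] J(2) by (simp add: card_image)
  \<comment> \<open>the partners in \<open>T\<close> of the points of \<open>J\<close>\<close>
  define J' where "J' = {x \<in> T. f x \<in> f ` J}"
  have J'T: "J' \<subseteq> T" by (auto simp: J'_def)
  have finJ': "finite J'" using J'T finT by (rule finite_subset)
  have fJ: "f ` J \<subseteq> f ` T" using J(1) T(3) by blast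
  have "f ` J' = f ` T \<inter> f ` J" by (auto simp: J'_def)
  then have fJ': "f ` J' = f ` J" using fJ by blast
  have cJ': "card J' = j"
    using card_image[OF inj_on_subset[OF T(2) J'T]] fJ' cfJ by simp
  have "k - 2 * j \<le> card (T - J')"
    using card_Diff_subset[OF finJ' J'T] cT cJ' lower by simp
  then obtain C where C: "C \<subseteq> T - J'" "card C = k - 2 * j" "finite C"
    by (rule obtain_subset_with_card_n)
  have cJC: "card (J' \<union> C) = k - j"
    using C cJ' finJ' upper(2) by (subst card_Un_disjoint) auto
  have "card (J \<union> (J' \<union> C)) = card J + card (J' \<union> C)"
    using J C finJ' J'T by (intro card_Un_disjoint) auto
  then have card_e: "card (J \<union> (J' \<union> C)) = k" using J(2) cJC upper(2) by simp
  have "f ` (J \<union> (J' \<union> C)) = f ` (J' \<union> C)" using fJ' by blast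
  moreover have "card (f ` (J' \<union> C)) = card (J' \<union> C)"
    using J'T C(1) by (intro card_image inj_on_subset[OF T(2)]) auto
  ultimately have "card (f ` (J \<union> (J' \<union> C))) + j = k" using cJC upper(2) by simp
  moreover have "J \<union> (J' \<union> C) \<subseteq> H" using J(1) J'T C(1) T(1) by blast
  ultimately show ?thesis using card_e by blast
qed

lemma card_le_twice_card_image:
  assumes "finite H" "fibres_le_two f H"
  shows "card H \<le> 2 * card (f ` H)"
proof -
  obtain T where T: "T \<subseteq> H" "inj_on f T" "f ` T = f ` H"
    by (rule exists_transversal)
  have "card (H - T) = card (f ` (H - T))"
    using inj_on_off_transversal[OF assms(2) T(1,3)] by (simp add: card_image)
  also have "\<dots> \<le> card (f ` H)" using assms(1) by (intro card_mono) auto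
  finally have "card (H - T) \<le> card (f ` H)" .
  moreover have "card T = card (f ` H)" using card_image[OF T(2)] T(3) by simp
  moreover have "card (H - T) = card H - card T"
    using T(1) assms(1) by (intro card_Diff_subset) (auto intro: finite_subset)
  ultimately show ?thesis by linarith
qed

section \<open>Parities of defects\<close>

text \<open>For \<open>s = max 1 (k - card (f ` H))\<close>, the defect \<open>s\<close> always occurs; if it is even, then it is at
  least \<open>2\<close>, and the size of \<open>H\<close> leaves room for the defect \<open>s + 1\<close>.\<close>

lemma exists_subset_odd_defect:
  assumes fin: "finite H" and two: "fibres_le_two f H" and k: "k \<ge> 2"
    and size: "card H \<ge> k + 1" "odd k \<Longrightarrow> card H \<ge> k + 2"
    and "card (f ` H) < card H"
  shows "\<exists>e\<subseteq>H. card e = k \<and> odd (k - card (f ` e))"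
proof -
  define s where "s = max 1 (k - card (f ` H))"
  define j where "j = (if odd s then s else s + 1)"
  have half: "card H \<le> 2 * card (f ` H)" using fin two by (rule card_le_twice_card_image)
  have jodd: "odd j" by (simp add: j_def)
  have "k \<le> card (f ` H) + j" by (auto simp: j_def s_def)
  moreover have "card (f ` H) + j \<le> card H"
    using assms(6) size(1) by (auto simp: j_def s_def max_def split: if_splits)
  moreover have "2 * j \<le> k"
  proof (cases "k \<le> card (f ` H) + 1")
    case True
    then have "s = 1" by (simp add: s_def)
    then show ?thesis using k by (simp add: j_def)
  next
    case False
    \<comment> \<open>Here \<open>s = k - card (f ` H)\<close>, so the claim says \<open>k + 2 \<le> 2 * card (f ` H)\<close>. For even \<open>k\<close> the
      bound \<open>card H \<ge> k + 1\<close> suffices, since \<open>2 * card (f ` H)\<close> is even too.\<close>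
    have "2 * (s + 1) \<le> k"
    proof (cases "odd k")
      case True
      then have "k + 2 \<le> 2 * card (f ` H)" using size(2) half by linarith
      then show ?thesis using False by (auto simp: s_def max_def)
    next
      case even: False
      have "k + 1 \<le> 2 * card (f ` H)" using size(1) half by linarith
      then have "k + 2 \<le> 2 * card (f ` H)" using even by presburger
      then show ?thesis using False by (auto simp: s_def max_def)
    qed
    then show ?thesis by (auto simp: j_def)
  qed
  ultimately obtain e where e: "e \<subseteq> H" "card e = k" "card (f ` e) + j = k"
    using exists_subset_with_defect[OF fin two] by blast
  then have "k - card (f ` e) = j" by simp
  then show ?thesis using e jodd by auto
qed

text \<open>The same argument with \<open>s = max 2 (k - card (f ` H))\<close>: if \<open>s\<close> is odd, then it is at least \<open>3\<close>,
  so it equals \<open>k - card (f ` H)\<close>, and there is room for the defect \<open>s + 1\<close>.\<close>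

lemma exists_subset_even_pos_defect:
  assumes fin: "finite H" and two: "fibres_le_two f H" and k: "k \<ge> 4"
    and size: "card H \<ge> k + 2" and img: "card (f ` H) + 2 \<le> card H"
  shows "\<exists>e\<subseteq>H. card e = k \<and> card (f ` e) < k \<and> even (k - card (f ` e))"
proof -
  define s where "s = max 2 (k - card (f ` H))"
  define j where "j = (if even s then s else s + 1)"
  have half: "card H \<le> 2 * card (f ` H)" using fin two by (rule card_le_twice_card_image)
  have jeven: "even j" "j > 0" by (auto simp: j_def s_def)
  have "k \<le> card (f ` H) + j" by (auto simp: j_def s_def)
  moreover have "card (f ` H) + j \<le> card H"
    using img size by (auto simp: j_def s_def max_def split: if_splits)
  moreover have "2 * j \<le> k"
  proof (cases "k \<le> card (f ` H) + 2")
    case True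
    then have "s = 2" by (simp add: s_def)
    then show ?thesis using k by (simp add: j_def)
  next
    case False
    then have "2 * (s + 1) \<le> k" using size half by (auto simp: s_def max_def)
    then show ?thesis by (auto simp: j_def)
  qed
  ultimately obtain e where e: "e \<subseteq> H" "card e = k" "card (f ` e) + j = k"
    using exists_subset_with_defect[OF fin two] by blast
  then have "k - card (f ` e) = j" "card (f ` e) < k" using jeven(2) by auto
  then show ?thesis using e jeven(1) by auto
qed

section \<open>The doubled coloring\<close>

text \<open>If all \<open>k\<close>-subsets of \<open>H\<close> on which \<open>f\<close> is injective have an image with the property \<open>P\<close>,
  then all \<open>k\<close>-subsets of the image of \<open>H\<close> have it, because they lift to a transversal.  Hence
  a subset of any size \<open>m\<close> up to \<open>card (f ` H)\<close> will do.\<close>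

lemma exists_projected_homogeneous:
  assumes "m \<le> card (f ` H)"
    and "\<And>e. e \<subseteq> H \<Longrightarrow> card e = k \<Longrightarrow> card (f ` e) = k \<Longrightarrow> P (f ` e)"
  shows "\<exists>L\<subseteq>f ` H. card L = m \<and> (\<forall>e\<subseteq>L. card e = k \<longrightarrow> P e)"
proof -
  obtain T where T: "T \<subseteq> H" "inj_on f T" "f ` T = f ` H"
    by (rule exists_transversal)
  obtain L where L: "L \<subseteq> f ` H" "card L = m"
    using obtain_subset_with_card_n[OF assms(1)] by blast
  have "P e" if e: "e \<subseteq> L" "card e = k" for e
  proof -
    have "e \<subseteq> f ` T" using e(1) L(1) T(3) by blast
    then obtain e' where e': "e' \<subseteq> T" "e = f ` e'" by (auto simp: subset_image_iff)
    have "card e' = k"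
      using card_image[OF inj_on_subset[OF T(2) e'(1)]] e'(2) e(2) by simp
    then show ?thesis using assms(2)[of e'] e' e(2) T(1) by auto
  qed
  then show ?thesis using L by blast
qed

lemma not_partn_lst_double:
  fixes k p q n :: nat
  assumes k: "k \<ge> 4" and p: "p \<ge> k + 2"
    and q: "q \<ge> k + 1" "odd k \<Longrightarrow> q \<ge> k + 2"
    and not_small: "\<not> partn_lst {1..n} [p - 1, q] k"
  shows "\<not> partn_lst {1..2 * n} [p, q] k"
proof
  assume big: "partn_lst {1..2 * n} [p, q] k"
  obtain red where red: "\<not> ((\<exists>L\<subseteq>{1..n}. card L = p - 1 \<and> (\<forall>e\<subseteq>L. card e = k \<longrightarrow> red e)) \<or>
      (\<exists>L\<subseteq>{1..n}. card L = q \<and> (\<forall>e\<subseteq>L. card e = k \<longrightarrow> \<not> red e)))"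
    using not_small unfolding partn_lst_red_blue_iff not_all by (rule exE)
  have
    no_red: "\<And>L. L \<subseteq> {1..n} \<Longrightarrow> card L = p - 1 \<Longrightarrow> \<not> (\<forall>e\<subseteq>L. card e = k \<longrightarrow> red e)" and
    no_blue: "\<And>L. L \<subseteq> {1..n} \<Longrightarrow> card L = q \<Longrightarrow> \<not> (\<forall>e\<subseteq>L. card e = k \<longrightarrow> \<not> red e)"
    using red by simp_all
  define f :: "nat \<Rightarrow> nat" where "f x = (x + 1) div 2" for x
  \<comment> \<open>\<open>k - card (f ` e)\<close> is the defect of \<open>e\<close>\<close>
  define red2 where
    "red2 e = (if card (f ` e) = k then red (f ` e) else odd (k - card (f ` e)))" for e
  have half: "x = 2 * f x \<or> x + 1 = 2 * f x" for x
    unfolding f_def by presburger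
  have two: "fibres_le_two f A" for A
    unfolding fibres_le_two_def
  proof (intro ballI impI)
    fix x y z assume "f x = f y" "f y = f z"
    then show "x = y \<or> y = z \<or> x = z"
      using half[of x] half[of y] half[of z] by linarith
  qed
  have img: "f ` H \<subseteq> {1..n}" if "H \<subseteq> {1..2 * n}" for H
  proof
    fix y assume "y \<in> f ` H"
    then obtain x where x: "y = f x" "x \<in> H" by blast
    then have "1 \<le> x" "x \<le> 2 * n" using that by auto
    then show "y \<in> {1..n}" using half[of x] x(1) by auto
  qed
  have "(\<exists>H\<subseteq>{1..2 * n}. card H = p \<and> (\<forall>e\<subseteq>H. card e = k \<longrightarrow> red2 e)) \<or>
        (\<exists>H\<subseteq>{1..2 * n}. card H = q \<and> (\<forall>e\<subseteq>H. card e = k \<longrightarrow> \<not> red2 e))"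
    using big[unfolded partn_lst_red_blue_iff, THEN spec, of red2] .
  then show False
  proof
    assume "\<exists>H\<subseteq>{1..2 * n}. card H = p \<and> (\<forall>e\<subseteq>H. card e = k \<longrightarrow> red2 e)"
    then obtain H where H: "H \<subseteq> {1..2 * n}" "card H = p" "\<And>e. e \<subseteq> H \<Longrightarrow> card e = k \<Longrightarrow> red2 e"
      by blast
    have fin: "finite H" using H(1) by (rule finite_subset) simp
    have "\<not> card (f ` H) + 2 \<le> card H"
    proof
      assume "card (f ` H) + 2 \<le> card H"
      then obtain e where "e \<subseteq> H" "card e = k" "card (f ` e) < k" "even (k - card (f ` e))"
        using exists_subset_even_pos_defect[OF fin two k] p H(2) by blast
      then show False using H(3)[of e] by (simp add: red2_def)
    qed
    then have "p - 1 \<le> card (f ` H)" using H(2) by simp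
    moreover have "red (f ` e)" if "e \<subseteq> H" "card e = k" "card (f ` e) = k" for e
      using H(3)[OF that(1,2)] that(3) by (simp add: red2_def)
    ultimately have "\<exists>L\<subseteq>f ` H. card L = p - 1 \<and> (\<forall>e\<subseteq>L. card e = k \<longrightarrow> red e)"
      by (rule exists_projected_homogeneous)
    then obtain L where "L \<subseteq> f ` H" "card L = p - 1" "\<forall>e\<subseteq>L. card e = k \<longrightarrow> red e"
      by blast
    then show False using no_red[of L] img[OF H(1)] by blast
  next
    assume "\<exists>H\<subseteq>{1..2 * n}. card H = q \<and> (\<forall>e\<subseteq>H. card e = k \<longrightarrow> \<not> red2 e)"
    then obtain H where H: "H \<subseteq> {1..2 * n}" "card H = q" "\<And>e. e \<subseteq> H \<Longrightarrow> card e = k \<Longrightarrow> \<not> red2 e"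
      by blast
    have fin: "finite H" using H(1) by (rule finite_subset) simp
    have "\<not> card (f ` H) < card H"
    proof
      assume "card (f ` H) < card H"
      then obtain e where e: "e \<subseteq> H" "card e = k" "odd (k - card (f ` e))"
        using exists_subset_odd_defect[OF fin two, of k] k q H(2) by auto
      then have "card (f ` e) \<noteq> k" by auto
      then show False using H(3)[of e] e by (simp add: red2_def)
    qed
    then have "q \<le> card (f ` H)" using H(2) by simp
    moreover have "\<not> red (f ` e)" if "e \<subseteq> H" "card e = k" "card (f ` e) = k" for e
      using H(3)[OF that(1,2)] that(3) by (simp add: red2_def)
    ultimately have "\<exists>L\<subseteq>f ` H. card L = q \<and> (\<forall>e\<subseteq>L. card e = k \<longrightarrow> \<not> red e)"
      by (rule exists_projected_homogeneous)
    then obtain L where "L \<subseteq> f ` H" "card L = q" "\<forall>e\<subseteq>L. card e = k \<longrightarrow> \<not> red e"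
      by blast
    then show False using no_blue[of L] img[OF H(1)] by blast
  qed
qed

lemma partn_lst_superset:
  assumes "partn_lst V \<alpha> k" "V \<subseteq> W"
  shows "partn_lst W \<alpha> k"
  unfolding partn_lst_def monochromatic_def
proof
  fix f assume "f \<in> nsets W k \<rightarrow> {..<length \<alpha>}"
  then have "f \<in> nsets V k \<rightarrow> {..<length \<alpha>}"
    using nsets_mono[OF assms(2)] by blast
  then obtain i H where "i < length \<alpha>" "H \<in> nsets V (\<alpha> ! i)" "f ` nsets H k \<subseteq> {i}"
    using assms(1) unfolding partn_lst_def monochromatic_def by blast
  then show "\<exists>i<length \<alpha>. \<exists>H\<in>nsets W (\<alpha> ! i). f ` nsets H k \<subseteq> {i}"
    using nsets_mono[OF assms(2)] by blast
qed

lemma ramsey_number_double: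
  fixes k p q :: nat
  assumes "k \<ge> 4" "p \<ge> k + 2" "q \<ge> k + 1" "odd k \<Longrightarrow> q \<ge> k + 2"
  shows "int (ramsey_number k p q) \<ge> 2 * (int (ramsey_number k (p - 1) q) - 1) + 1"
proof (cases "ramsey_number k (p - 1) q")
  case 0
  \<comment> \<open>the lower bound is then the negative integer \<open>- 1\<close>\<close>
  then show ?thesis by simp
next
  case (Suc n)
  then have "n < (LEAST N. partn_lst {1..N} [p - 1, q] k)"
    by (simp add: ramsey_number_def)
  then have "\<not> partn_lst {1..n} [p - 1, q] k" by (rule not_less_Least)
  then have not_big: "\<not> partn_lst {1..2 * n} [p, q] k"
    using assms by (intro not_partn_lst_double)
  have "2 * n < ramsey_number k p q"
  proof (rule ccontr)
    assume "\<not> 2 * n < ramsey_number k p q"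
    then have "{1..ramsey_number k p q} \<subseteq> {1..2 * n}" by auto
    with partn_lst_ramsey_number[of k p q] have "partn_lst {1..2 * n} [p, q] k"
      by (rule partn_lst_superset)
    then show False using not_big by contradiction
  qed
  then show ?thesis using Suc by simp
qed

theorem theorem4:
  shows "(\<forall>k p q :: nat. even k \<and> k \<ge> 4 \<and> p \<ge> k + 2 \<and> q \<ge> k + 1 \<longrightarrow>
            int (ramsey_number k p q) \<ge> 2 * (int (ramsey_number k (p - 1) q) - 1) + 1) \<and>
         (\<forall>k p q :: nat. odd k \<and> k \<ge> 5 \<and> p \<ge> k + 2 \<and> q \<ge> k + 2 \<longrightarrow>
            int (ramsey_number k p q) \<ge> 2 * (int (ramsey_number k (p - 1) q) - 1) + 1)"
  by (intro conjI allI impI; rule ramsey_number_double) auto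

end
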